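(* Let $\mathcal{F}_1,\dots,\mathcal{F}_6$ be families of compact connected sets in $\mathbb{R}^2$. Suppose that for all indices $1\le i_1<i_2<i_3\le 6$ and all sets $A_1\in\mathcal{F}_{i_1}$, $A_2\in\mathcal{F}_{i_2}$, $A_3\in\mathcal{F}_{i_3}$, the sets $A_1,A_2,A_3$ form a tight triple. Then there exists $i\in\{1,\dots,6\}$ such that the line-piercing number of $\mathcal{F}_i$ is at most $3$.
   Context: Three compact connected sets $A,B,C$ in the plane form a tight triple if $\operatorname{conv}(A\cup B)\cap\operatorname{conv}(A\cup C)\cap\operatorname{conv}(B\cup C)\neq\emptyset$, where $\operatorname{conv}$ denotes the convex hull. A family $\mathcal{F}$ of sets in the plane is pierced by $k$ lines if there are $k$ lines in the plane whose union intersects every set in $\mathcal{F}$. The line-piercing number of $\mathcal{F}$ is the minimum $k$ such that $\mathcal{F}$ is pierced by $k$ lines. The families are not assumed to be finite. *)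

theory Defs
  imports "HOL-Analysis.Analysis" "HOL-Library.Extended_Nat"
begin

definition tight_triple :: "(real^2) set \<Rightarrow> (real^2) set \<Rightarrow> (real^2) set \<Rightarrow> bool" where
  "tight_triple A B C \<longleftrightarrow>
     convex hull (A \<union> B) \<inter> convex hull (A \<union> C) \<inter> convex hull (B \<union> C) \<noteq> {}"

definition is_line :: "(real^2) set \<Rightarrow> bool" where
  "is_line L \<longleftrightarrow> affine L \<and> aff_dim L = 1"

definition pierced_by_lines :: "(real^2) set set \<Rightarrow> nat \<Rightarrow> bool" where
  "pierced_by_lines F k \<longleftrightarrow>
     (\<exists>\<L>. finite \<L> \<and> card \<L> = k \<and> (\<forall>L\<in>\<L>. is_line L) \<and> (\<forall>A\<in>F. \<Union>\<L> \<inter> A \<noteq> {}))"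

text \<open>The minimum is taken in the extended naturals, so a family that no finite
  number of lines pierces has line-piercing number \<open>\<infinity>\<close>.\<close>

definition line_piercing_number :: "(real^2) set set \<Rightarrow> enat" where
  "line_piercing_number F = (INF k\<in>{k. pierced_by_lines F k}. enat k)"

end

theory Submission
  imports Defs
begin

text \<open>
  Three affine lines can be parametrised by a compact space once the line at infinity is
  admitted, so it suffices to treat finite families, whose members lie in a common disc. A point
  \<open>x\<close> of the five-dimensional simplex cuts the boundary of the disc into six arcs; the three chords
  joining opposite endpoints bound, for each arc, a wedge containing it, and the wedge of an arc
  of length zero misses the disc. A connected set that avoids all three chords lies in one of
  the six wedges. If no family is pierced by three lines, the sets of \<open>x\<close> for which the \<open>i\<close>-th
  wedge contains a member of the \<open>j\<close>-th family form six open KKM covers, and the colourful KKM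
  theorem gives an \<open>x\<close> and members of six different families in the six wedges. Finally, three lines
  leave empty one of two opposite sign patterns, and therefore three alternate wedges contain sets
  that are not tight. Families containing the empty set are treated separately, by projecting two
  other families to a line.
\<close>

subsection \<open>Hall's theorem and the colourful KKM theorem\<close>

text \<open>Induction on \<open>card I\<close>. If a proper nonempty \<open>J\<close> has exactly
  \<open>card J\<close> candidates, \<open>J\<close> and \<open>I - J\<close> are matched
  separately, the latter avoiding the candidates of \<open>J\<close>. Otherwise every such
  \<open>J\<close> has a spare candidate, so an arbitrary first choice \<open>a\<close> does no
  harm.\<close>

lemma hall_marriage:
  assumes "finite I" "\<And>i. i \<in> I \<Longrightarrow> finite (S i)"
    and "\<And>K. K \<subseteq> I \<Longrightarrow> card K \<le> card (\<Union>(S ` K))"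
  shows "\<exists>r. inj_on r I \<and> (\<forall>i\<in>I. r i \<in> S i)"
  using assms
proof (induction "card I" arbitrary: I S rule: less_induct)
  case less
  note fin = less.prems(1,2) and hall = less.prems(3)
  consider "I = {}" | (tight) J where "J \<subset> I" "J \<noteq> {}" "card (\<Union>(S ` J)) = card J"
    | (loose) "I \<noteq> {}" "\<And>J. J \<subset> I \<Longrightarrow> J \<noteq> {} \<Longrightarrow> card J < card (\<Union>(S ` J))"
    using hall by (metis le_neq_implies_less psubset_imp_subset)
  then show ?case
  proof cases
    case 1
    then show ?thesis by simp
  next
    case tight
    let ?T = "\<Union>(S ` J)"
    have finJ: "finite J"
      using tight fin by (auto intro: finite_subset)
    then have finT: "finite ?T"
      using tight fin by auto
    have "\<exists>r. inj_on r J \<and> (\<forall>i\<in>J. r i \<in> S i)"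
    proof (rule less.hyps)
      show "card J < card I"
        using tight fin by (intro psubset_card_mono)
      show "card K \<le> card (\<Union>(S ` K))" if "K \<subseteq> J" for K
        using that tight by (intro hall) auto
    qed (use finJ fin tight in auto)
    then obtain r where r: "inj_on r J" "\<forall>i\<in>J. r i \<in> S i" by blast
    have "\<exists>r. inj_on r (I - J) \<and> (\<forall>i\<in>I - J. r i \<in> S i - ?T)"
    proof (rule less.hyps)
      show "card (I - J) < card I"
        using tight fin by (intro psubset_card_mono) auto
      fix K assume K: "K \<subseteq> I - J"
      then have finK: "finite K" using fin finite_subset by blast
      have "card K + card J = card (K \<union> J)"
        using K finK finJ by (subst card_Un_disjoint) auto
      also have "\<dots> \<le> card (\<Union>(S ` (K \<union> J)))"
        using K tight by (intro hall) auto
      also have "\<Union>(S ` (K \<union> J)) = (\<Union>i\<in>K. S i - ?T) \<union> ?T" by auto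
      also have "card \<dots> = card (\<Union>i\<in>K. S i - ?T) + card ?T"
        using K fin finK finT by (intro card_Un_disjoint) auto
      finally show "card K \<le> card (\<Union>i\<in>K. S i - ?T)"
        using tight by simp
    qed (use fin in auto)
    then obtain s where s: "inj_on s (I - J)" "\<forall>i\<in>I - J. s i \<in> S i - ?T" by blast
    show ?thesis
    proof (intro exI conjI ballI)
      have "r ` J \<inter> s ` (I - J) = {}"
        using r(2) s(2) by fastforce
      then have "inj_on (\<lambda>i. if i \<in> J then r i else s i) (J \<union> (I - J))"
        using r(1) s(1) by (intro inj_on_disjoint_Un)
      then show "inj_on (\<lambda>i. if i \<in> J then r i else s i) I"
        using tight(1) by (simp add: Un_absorb1 psubset_imp_subset)
    qed (use r s in auto)
  next
    case loose
    then obtain i where i: "i \<in> I" by blast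
    have "S i \<noteq> {}" using hall[of "{i}"] i by auto
    then obtain a where a: "a \<in> S i" by blast
    have "\<exists>r. inj_on r (I - {i}) \<and> (\<forall>k\<in>I - {i}. r k \<in> S k - {a})"
    proof (rule less.hyps)
      show "card (I - {i}) < card I"
        using i fin by (meson card_Diff1_less)
      fix K assume K: "K \<subseteq> I - {i}"
      then have finK: "finite K" "finite (\<Union>(S ` K))"
        using fin by (auto intro: finite_subset)
      show "card K \<le> card (\<Union>k\<in>K. S k - {a})"
      proof (cases "K = {}")
        case False
        then have "card K < card (\<Union>(S ` K))" using K i by (intro loose) auto
        moreover have "(\<Union>k\<in>K. S k - {a}) = \<Union>(S ` K) - {a}" by auto
        moreover have "card (\<Union>(S ` K)) - 1 \<le> card (\<Union>(S ` K) - {a})"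
          using finK by (simp add: card_Diff_singleton_if)
        ultimately show ?thesis by simp
      qed simp
    qed (use fin in auto)
    then obtain r where r: "inj_on r (I - {i})" "\<forall>k\<in>I - {i}. r k \<in> S k - {a}" by blast
    show ?thesis
    proof (intro exI conjI ballI)
      show "inj_on (r(i := a)) I"
        using r unfolding inj_on_def by (metis Diff_iff fun_upd_apply singletonD singletonI)
    qed (use r a in auto)
  qed
qed

section \<open>The colourful KKM theorem from Brouwer's fixed point theorem\<close>

definition unit_simplex :: "(real^'n) set" where
  "unit_simplex = {x. (\<forall>i. 0 \<le> x $ i) \<and> (\<Sum>i\<in>UNIV. x $ i) = 1}"

lemma convex_unit_simplex: "convex (unit_simplex :: (real^'n) set)"
  unfolding unit_simplex_def convex_def
  by (auto simp: sum.distrib simp flip: sum_distrib_left)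

lemma compact_unit_simplex: "compact (unit_simplex :: (real^'n) set)"
proof (rule compact_Int_closed[of "cbox 0 1" "{x. (\<Sum>i\<in>UNIV. x $ i) = 1}", THEN subst[of _ _ compact, rotated]])
  have "x $ i \<le> 1" if "\<forall>i. 0 \<le> x $ i" "(\<Sum>i\<in>UNIV. x $ i) = 1" for x :: "real^'n" and i
    using that member_le_sum[of i UNIV "\<lambda>i. x $ i"] by auto
  then show "cbox 0 1 \<inter> {x. (\<Sum>i\<in>UNIV. x $ i) = 1} = (unit_simplex :: (real^'n) set)"
    by (auto simp: unit_simplex_def mem_box_cart)
  show "closed {x::real^'n. (\<Sum>i\<in>UNIV. x $ i) = 1}"
    by (intro closed_Collect_eq continuous_intros)
qed simp

lemma unit_simplex_nonempty: "(unit_simplex :: (real^'n) set) \<noteq> {}"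
proof -
  have "(\<chi> i. 1 / CARD('n)) \<in> (unit_simplex :: (real^'n) set)"
    by (simp add: unit_simplex_def)
  then show ?thesis by blast
qed

text \<open>At a fixed point of the normalisation of \<open>x + max 0 (1 - P x)\<close> no coordinate of \<open>P x\<close> is
  below \<open>1\<close>.\<close>

lemma facet_preserving_attains_barycentre:
  fixes P :: "'n::finite \<Rightarrow> real^'n \<Rightarrow> real"
  assumes cont: "\<And>i. continuous_on unit_simplex (P i)"
    and total: "\<And>x. x \<in> unit_simplex \<Longrightarrow> (\<Sum>i\<in>UNIV. P i x) = CARD('n)"
    and facet: "\<And>i x. x \<in> unit_simplex \<Longrightarrow> x $ i = 0 \<Longrightarrow> P i x = 0"
  shows "\<exists>x\<in>unit_simplex. \<forall>i. P i x = 1"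
proof -
  define s where "s x = (\<Sum>i\<in>UNIV. max 0 (1 - P i x))" for x
  define h where "h x = (\<chi> i. (x $ i + max 0 (1 - P i x)) / (1 + s x))" for x
  have s0: "s x \<ge> 0" for x
    unfolding s_def by (intro sum_nonneg) auto
  have s0': "1 + s x \<noteq> 0" for x
    using s0[of x] by linarith
  have "continuous_on unit_simplex h"
    unfolding h_def s_def
    by (intro continuous_intros cont) (use s0' in \<open>auto simp: s_def\<close>)
  moreover have "h x \<in> unit_simplex" if "x \<in> unit_simplex" for x
  proof -
    have "(\<Sum>i\<in>UNIV. h x $ i) = (\<Sum>i\<in>UNIV. x $ i + max 0 (1 - P i x)) / (1 + s x)"
      unfolding h_def by (simp add: sum_divide_distrib)
    also have "\<dots> = 1"
      using that s0'[of x] by (simp add: unit_simplex_def sum.distrib s_def)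
    finally show ?thesis
      using that s0[of x] by (auto simp: unit_simplex_def h_def)
  qed
  ultimately obtain x where x: "x \<in> unit_simplex" "h x = x"
    using brouwer[OF compact_unit_simplex convex_unit_simplex unit_simplex_nonempty] by blast
  have fixed: "x $ i * s x = max 0 (1 - P i x)" for i
  proof -
    have "x $ i = (x $ i + max 0 (1 - P i x)) / (1 + s x)"
      using arg_cong[OF x(2), of "\<lambda>v. v $ i"] by (simp add: h_def)
    then show ?thesis using s0'[of x] by (simp add: field_simps)
  qed
  \<comment> \<open>Otherwise a coordinate with \<open>P i x \<ge> 1\<close> has
    \<open>x $ i = 0\<close>, hence \<open>P i x = 0\<close> by \<open>facet\<close>; so all
    \<open>P i x\<close> are below 1, against \<open>total\<close>.\<close>
  have "s x = 0"
  proof (rule ccontr)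
    assume "s x \<noteq> 0"
    have "P i x < 1" for i
    proof (rule ccontr)
      assume *: "\<not> P i x < 1"
      then have "x $ i = 0" using fixed[of i] \<open>s x \<noteq> 0\<close> by simp
      then show False using * facet[OF x(1)] by simp
    qed
    then have "(\<Sum>i\<in>UNIV. P i x) < (\<Sum>i\<in>(UNIV::'n set). 1)"
      by (intro sum_strict_mono) auto
    then show False using total[OF x(1)] by simp
  qed
  then have ge: "P i x \<ge> 1" for i
    using fixed[of i] by simp
  have "(\<Sum>i\<in>UNIV. P i x - 1) = 0"
    using total[OF x(1)] by (simp add: sum_subtractf)
  then have "P i x = 1" for i
    using ge by (subst (asm) sum_nonneg_eq_0_iff) auto
  then show ?thesis using x(1) by blast
qed

text \<open>The \<open>C j i\<close> are the complements of the open cover members. Normalised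
  distances to them form a matrix with row sums 1; the previous lemma finds an \<open>x\<close>
  where the column sums are 1 too, and Hall's theorem picks a transversal in the support of this
  doubly stochastic matrix.\<close>

lemma colourful_KKM:
  fixes C :: "'c \<Rightarrow> 'n::finite \<Rightarrow> (real^'n) set"
  assumes J: "card J = CARD('n)"
    and clo: "\<And>j i. j \<in> J \<Longrightarrow> closed (C j i)"
    and facet: "\<And>j i x. j \<in> J \<Longrightarrow> x \<in> unit_simplex \<Longrightarrow> x $ i = 0 \<Longrightarrow> x \<in> C j i"
    and cover: "\<And>j x. j \<in> J \<Longrightarrow> x \<in> unit_simplex \<Longrightarrow> \<exists>i. x \<notin> C j i"
  shows "\<exists>x\<in>unit_simplex. \<exists>r. inj r \<and> (\<forall>i. r i \<in> J \<and> x \<notin> C (r i) i)"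
proof -
  have finJ: "finite J"
    using J by (metis card.infinite zero_less_card_finite less_irrefl)
  define d where "d j i x = infdist x (insert 0 (C j i))" for j i x
    \<comment> \<open>The point \<open>0\<close> off the simplex avoids the junk value of \<^const>\<open>infdist\<close> at \<open>{}\<close>.\<close>
  define D where "D j x = (\<Sum>i\<in>UNIV. d j i x)" for j x
  define p where "p j i x = d j i x / D j x" for j i x
  have d0: "d j i x \<ge> 0" for j i x
    by (simp add: d_def infdist_nonneg)
  have dpos: "d j i x > 0 \<longleftrightarrow> x \<notin> C j i" if "j \<in> J" "x \<in> unit_simplex" for j i x
  proof -
    have "x \<noteq> 0" using that by (auto simp: unit_simplex_def)
    moreover have "closed (insert 0 (C j i))" using clo[OF that(1)] by simp
    ultimately have "d j i x > 0" if "x \<notin> C j i"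
      unfolding d_def using that by (intro infdist_pos_not_in_closed) auto
    moreover have "d j i x = 0" if "x \<in> C j i"
      unfolding d_def using that by (intro infdist_zero) auto
    ultimately show ?thesis by fastforce
  qed
  have Dpos: "D j x > 0" if jx: "j \<in> J" "x \<in> unit_simplex" for j x
  proof -
    obtain i where "d j i x > 0"
      using cover[OF jx] dpos[OF jx] by blast
    then show ?thesis
      unfolding D_def using d0 by (intro sum_pos2[of UNIV i]) auto
  qed
  have p0: "p j i x \<ge> 0" if "j \<in> J" "x \<in> unit_simplex" for j i x
    using Dpos[OF that] d0 by (simp add: p_def)
  have p_row: "(\<Sum>i\<in>UNIV. p j i x) = 1" if "j \<in> J" "x \<in> unit_simplex" for j x
    using Dpos[OF that] unfolding p_def sum_divide_distrib[symmetric] D_def by simp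
  have p_C: "p j i x = 0" if "j \<in> J" "x \<in> unit_simplex" "x \<in> C j i" for j i x
    using dpos[OF that(1,2), of i] d0[of j i x] that(3) by (simp add: p_def)
  have "\<exists>x\<in>unit_simplex. \<forall>i. (\<Sum>j\<in>J. p j i x) = 1"
  proof (rule facet_preserving_attains_barycentre)
    show "continuous_on unit_simplex (\<lambda>x. \<Sum>j\<in>J. p j i x)" for i
      unfolding p_def D_def d_def
      by (intro continuous_intros) (auto simp flip: d_def D_def dest!: Dpos)
    show "(\<Sum>i\<in>UNIV. \<Sum>j\<in>J. p j i x) = CARD('n)" if "x \<in> unit_simplex" for x
      using that by (subst sum.swap) (simp add: p_row J)
    show "(\<Sum>j\<in>J. p j i x) = 0" if "x \<in> unit_simplex" "x $ i = 0" for i x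
      using that by (intro sum.neutral ballI p_C facet)
  qed
  then obtain x where x: "x \<in> unit_simplex" and p_col: "\<And>i. (\<Sum>j\<in>J. p j i x) = 1"
    by blast
  define S where "S i = {j\<in>J. x \<notin> C j i}" for i
  have "card K \<le> card (\<Union>(S ` K))" for K :: "'n set"
  proof -
    have "real (card K) = (\<Sum>i\<in>K. \<Sum>j\<in>J. p j i x)"
      by (simp add: p_col)
    also have "\<dots> = (\<Sum>j\<in>J. \<Sum>i\<in>K. p j i x)"
      by (rule sum.swap)
    also have "\<dots> = (\<Sum>j\<in>\<Union>(S ` K). \<Sum>i\<in>K. p j i x)"
    proof (rule sum.mono_neutral_right[OF finJ])
      show "\<forall>j\<in>J - \<Union>(S ` K). (\<Sum>i\<in>K. p j i x) = 0"
        by (intro ballI sum.neutral) (use x p_C in \<open>auto simp: S_def\<close>)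
    qed (auto simp: S_def)
    also have "\<dots> \<le> (\<Sum>j\<in>\<Union>(S ` K). 1)"
    proof (rule sum_mono)
      fix j assume "j \<in> \<Union>(S ` K)"
      then have "j \<in> J" by (auto simp: S_def)
      then show "(\<Sum>i\<in>K. p j i x) \<le> 1"
        using sum_mono2[of UNIV K "\<lambda>i. p j i x"] p0 p_row x by auto
    qed
    finally show ?thesis by simp
  qed
  moreover have "finite (S i)" for i
    using finJ by (simp add: S_def)
  ultimately have "\<exists>r. inj r \<and> (\<forall>i\<in>UNIV. r i \<in> S i)"
    by (intro hall_marriage) auto
  then obtain r where "inj r" "\<forall>i. r i \<in> S i"
    by blast
  then show ?thesis
    using x by (auto simp: S_def)
qed

subsection \<open>Chords of a circle\<close>

definition dir :: "real \<Rightarrow> real^2" where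
  "dir t = vector [cos t, sin t]"

lemma inner_dir: "dir t \<bullet> q = cos t * q $ 1 + sin t * q $ 2"
  by (simp add: dir_def inner_vec_def sum_2)

lemma dir_nonzero: "dir t \<noteq> 0"
proof
  assume "dir t = 0"
  then have "cos t = 0" "sin t = 0"
    by (auto simp: dir_def vec_eq_iff forall_2)
  then show False using sin_cos_squared_add[of t] by simp
qed

text \<open>\<open>chord R \<alpha> \<beta>\<close> vanishes on the line through the points \<open>R *\<^sub>R dir \<alpha>\<close> and \<open>R *\<^sub>R dir \<beta>\<close>, and
  on the tangent if the two coincide; for \<open>\<alpha> < \<beta> < \<alpha> + 2\<pi>\<close> it is positive on the open arc
  from \<open>\<alpha>\<close> to \<open>\<beta>\<close>.\<close>

definition chord :: "real \<Rightarrow> real \<Rightarrow> real \<Rightarrow> real^2 \<Rightarrow> real" where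
  "chord R \<alpha> \<beta> q = dir ((\<alpha> + \<beta>) / 2) \<bullet> q - R * cos ((\<beta> - \<alpha>) / 2)"

text \<open>The normal turns by \<pi> and half the arc length passes to its supplement, so both
  terms change sign: the same line, now bounding the complementary arc.\<close>

lemma chord_swap: "chord R \<beta> (\<alpha> + 2 * pi) q = - chord R \<alpha> \<beta> q"
proof -
  have "(\<beta> + (\<alpha> + 2 * pi)) / 2 = (\<alpha> + \<beta>) / 2 + pi"
    and "(\<alpha> + 2 * pi - \<beta>) / 2 = pi - (\<beta> - \<alpha>) / 2"
    by (simp_all add: field_simps)
  then show ?thesis
    unfolding chord_def inner_dir by (simp only:) (simp add: cos_add sin_add cos_diff)
qed

text \<open>Moving the endpoint forward enlarges the part of the disc cut off. With the starting
  point fixed, the value at half arc length \<open>t\<close> is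
  \<open>Q * sin t - P * cos t\<close>, and comparing two such values leaves only a multiple of
  \<open>P\<close>.\<close>

lemma chord_monotone:
  assumes "norm q \<le> R" "\<alpha> \<le> \<beta>" "\<beta> \<le> \<gamma>" "\<gamma> \<le> \<alpha> + 2 * pi" "chord R \<alpha> \<beta> q > 0"
  shows "chord R \<alpha> \<gamma> q \<ge> 0"
proof (rule ccontr)
  assume neg: "\<not> chord R \<alpha> \<gamma> q \<ge> 0"
  \<comment> \<open>\<open>P\<close> is the distance of \<open>q\<close> from the tangent at
    \<open>R *\<^sub>R dir \<alpha>\<close>, nonnegative in the disc; \<open>Q\<close> is the
    coordinate of \<open>q\<close> along that tangent.\<close>
  define b c P Q where "b = (\<beta> - \<alpha>) / 2" and "c = (\<gamma> - \<alpha>) / 2"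
    and "P = R - dir \<alpha> \<bullet> q" and "Q = cos \<alpha> * q $ 2 - sin \<alpha> * q $ 1"
  have bc: "0 \<le> b" "b \<le> c" "c \<le> pi"
    using assms by (auto simp: b_def c_def)
  have "norm (dir \<alpha>) = 1"
    by (simp add: norm_eq_1 inner_dir) (simp add: dir_def flip: power2_eq_square)
  then have "P \<ge> 0"
    using norm_cauchy_schwarz[of "dir \<alpha>" q] assms(1) by (simp add: P_def)
  have *: "chord R \<alpha> \<delta> q = Q * sin ((\<delta> - \<alpha>) / 2) - P * cos ((\<delta> - \<alpha>) / 2)" for \<delta>
  proof -
    have "(\<alpha> + \<delta>) / 2 = \<alpha> + (\<delta> - \<alpha>) / 2" by (simp add: field_simps)
    then show ?thesis
      by (simp only: chord_def inner_dir P_def Q_def cos_add sin_add) (simp add: algebra_simps)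
  qed
  have b: "chord R \<alpha> \<beta> q = Q * sin b - P * cos b" and c: "chord R \<alpha> \<gamma> q = Q * sin c - P * cos c"
    by (simp_all add: * b_def c_def)
  have "chord R \<alpha> \<beta> q * sin c - chord R \<alpha> \<gamma> q * sin b = - (P * sin (c - b))"
    by (simp add: b c sin_diff algebra_simps)
  also have "\<dots> \<le> 0"
    using bc \<open>P \<ge> 0\<close> by (simp add: sin_ge_zero)
  finally have le: "chord R \<alpha> \<beta> q * sin c - chord R \<alpha> \<gamma> q * sin b \<le> 0" .
  have ge: "sin b \<ge> 0" "sin c \<ge> 0"
    using bc by (auto intro: sin_ge_zero)
  then have "chord R \<alpha> \<beta> q * sin c \<ge> 0" "chord R \<alpha> \<gamma> q * sin b \<le> 0"
    using assms(5) neg by (auto simp: mult_nonpos_nonneg)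
  with le have "chord R \<alpha> \<beta> q * sin c = 0" "chord R \<alpha> \<gamma> q * sin b = 0"
    by linarith+
  then have "sin c = 0" "sin b = 0"
    using assms(5) neg by auto
  \<comment> \<open>The value is \<open>- P\<close> at 0 and \<open>P\<close> at \<pi>. Being
    positive at \<open>b\<close> excludes \<open>b = 0\<close>, so \<open>b = c = pi\<close>, where
    the value is not negative.\<close>
  then have "b = 0 \<or> b = pi" "c = 0 \<or> c = pi"
    using bc sin_gt_zero[of b] sin_gt_zero[of c] by force+
  then show False
    using assms(5) neg b c bc \<open>P \<ge> 0\<close> by auto
qed

text \<open>The normals satisfy \<open>sin (m\<^sub>2 - m\<^sub>1) dir m\<^sub>0 - sin (m\<^sub>2 - m\<^sub>0) dir m\<^sub>1 + sin (m\<^sub>1 - m\<^sub>0) dir m\<^sub>2 = 0\<close>,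
  so the corresponding combination of the three affine functions is constant, which excludes
  one of two opposite sign patterns.\<close>

lemma sign_pattern_excluded:
  fixes c\<^sub>0 c\<^sub>1 c\<^sub>2 :: real
  assumes m: "m\<^sub>0 \<le> m\<^sub>1" "m\<^sub>1 \<le> m\<^sub>2" "m\<^sub>2 \<le> m\<^sub>0 + pi"
    and degenerate: "m\<^sub>0 = m\<^sub>1 \<Longrightarrow> c\<^sub>0 = c\<^sub>1" "m\<^sub>1 = m\<^sub>2 \<Longrightarrow> c\<^sub>1 = c\<^sub>2"
  shows "(\<forall>q. \<not> (dir m\<^sub>0 \<bullet> q > c\<^sub>0 \<and> dir m\<^sub>1 \<bullet> q < c\<^sub>1 \<and> dir m\<^sub>2 \<bullet> q > c\<^sub>2)) \<or>
         (\<forall>q. \<not> (dir m\<^sub>0 \<bullet> q < c\<^sub>0 \<and> dir m\<^sub>1 \<bullet> q > c\<^sub>1 \<and> dir m\<^sub>2 \<bullet> q < c\<^sub>2))"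
proof (cases "m\<^sub>0 = m\<^sub>1 \<or> m\<^sub>1 = m\<^sub>2")
  case True
  \<comment> \<open>Two lines coincide, and a pattern would demand opposite signs of the same
    function.\<close>
  then show ?thesis using degenerate by fastforce
next
  case False
  define s\<^sub>0 s\<^sub>1 s\<^sub>2 where "s\<^sub>0 = sin (m\<^sub>2 - m\<^sub>1)" and "s\<^sub>1 = sin (m\<^sub>2 - m\<^sub>0)" and "s\<^sub>2 = sin (m\<^sub>1 - m\<^sub>0)"
  \<comment> \<open>\<open>s\<^sub>1\<close> vanishes if \<open>m\<^sub>2 = m\<^sub>0 + pi\<close>;
    the outer two coefficients keep the later inequalities strict.\<close>
  have s: "s\<^sub>0 > 0" "s\<^sub>1 \<ge> 0" "s\<^sub>2 > 0"
    unfolding s\<^sub>0_def s\<^sub>1_def s\<^sub>2_def using m False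
    by (auto intro!: sin_gt_zero sin_ge_zero)
  have cs: "s\<^sub>0 * cos m\<^sub>0 - s\<^sub>1 * cos m\<^sub>1 + s\<^sub>2 * cos m\<^sub>2 = 0"
    and sn: "s\<^sub>0 * sin m\<^sub>0 - s\<^sub>1 * sin m\<^sub>1 + s\<^sub>2 * sin m\<^sub>2 = 0"
    by (simp_all add: s\<^sub>0_def s\<^sub>1_def s\<^sub>2_def sin_diff algebra_simps)
  have dep: "s\<^sub>0 * (dir m\<^sub>0 \<bullet> q) - s\<^sub>1 * (dir m\<^sub>1 \<bullet> q) + s\<^sub>2 * (dir m\<^sub>2 \<bullet> q) = 0" for q
  proof -
    have "s\<^sub>0 * (dir m\<^sub>0 \<bullet> q) - s\<^sub>1 * (dir m\<^sub>1 \<bullet> q) + s\<^sub>2 * (dir m\<^sub>2 \<bullet> q) =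
        (s\<^sub>0 * cos m\<^sub>0 - s\<^sub>1 * cos m\<^sub>1 + s\<^sub>2 * cos m\<^sub>2) * q $ 1 +
        (s\<^sub>0 * sin m\<^sub>0 - s\<^sub>1 * sin m\<^sub>1 + s\<^sub>2 * sin m\<^sub>2) * q $ 2"
      by (simp add: inner_dir algebra_simps)
    then show ?thesis by (simp add: cs sn)
  qed
  define K where "K = s\<^sub>0 * c\<^sub>0 - s\<^sub>1 * c\<^sub>1 + s\<^sub>2 * c\<^sub>2"
  have pos: "K < 0" if "dir m\<^sub>0 \<bullet> q > c\<^sub>0" "dir m\<^sub>1 \<bullet> q < c\<^sub>1" "dir m\<^sub>2 \<bullet> q > c\<^sub>2" for q
  proof -
    have "s\<^sub>0 * c\<^sub>0 < s\<^sub>0 * (dir m\<^sub>0 \<bullet> q)" "s\<^sub>1 * (dir m\<^sub>1 \<bullet> q) \<le> s\<^sub>1 * c\<^sub>1" "s\<^sub>2 * c\<^sub>2 < s\<^sub>2 * (dir m\<^sub>2 \<bullet> q)"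
      using that s by (auto intro: mult_left_mono)
    then show ?thesis using dep[of q] by (simp add: K_def)
  qed
  have neg: "K > 0" if "dir m\<^sub>0 \<bullet> q < c\<^sub>0" "dir m\<^sub>1 \<bullet> q > c\<^sub>1" "dir m\<^sub>2 \<bullet> q < c\<^sub>2" for q
  proof -
    have "s\<^sub>0 * (dir m\<^sub>0 \<bullet> q) < s\<^sub>0 * c\<^sub>0" "s\<^sub>1 * c\<^sub>1 \<le> s\<^sub>1 * (dir m\<^sub>1 \<bullet> q)" "s\<^sub>2 * (dir m\<^sub>2 \<bullet> q) < s\<^sub>2 * c\<^sub>2"
      using that s by (auto intro: mult_left_mono)
    then show ?thesis using dep[of q] by (simp add: K_def)
  qed
  show ?thesis
    using pos neg by (meson less_asym)
qed

subsection \<open>Piercing by three lines\<close>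

text \<open>The pair encodes a line by normal vector and offset, up to a common factor.\<close>

definition hits :: "(real^2) \<times> real \<Rightarrow> (real^2) set \<Rightarrow> bool" where
  "hits u A \<longleftrightarrow> (\<exists>q\<in>A. fst u \<bullet> q = snd u)"

lemma not_hits_imp_one_side:
  assumes "connected A" "\<not> hits (a, b) A"
  shows "(\<forall>q\<in>A. a \<bullet> q > b) \<or> (\<forall>q\<in>A. a \<bullet> q < b)"
proof (rule ccontr)
  assume "\<not> ?thesis"
  then obtain x y where "x \<in> A" "y \<in> A" "a \<bullet> x \<le> b" "b \<le> a \<bullet> y"
    by (auto simp: not_less)
  then show False
    using connected_ivt_hyperplane[OF assms(1)] assms(2) by (force simp: hits_def)
qed

text \<open>A pair \<open>(0, c)\<close> with \<open>c \<noteq> 0\<close> represents the line at infinity, which misses every set of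
  the plane. Admitting it makes the space of lines compact.\<close>

definition pierced3 :: "(real^2) set set \<Rightarrow> bool" where
  "pierced3 F \<longleftrightarrow> (\<exists>u v w. u \<noteq> 0 \<and> v \<noteq> 0 \<and> w \<noteq> 0 \<and> (\<forall>A\<in>F. hits u A \<or> hits v A \<or> hits w A))"

lemma pierced3I:
  assumes "\<And>A. A \<in> F \<Longrightarrow> hits (dir a, r) A \<or> hits (dir b, s) A \<or> hits (dir c, t) A"
  shows "pierced3 F"
  unfolding pierced3_def
  by (rule exI[of _ "(dir a, r)"], rule exI[of _ "(dir b, s)"], rule exI[of _ "(dir c, t)"])
    (use assms dir_nonzero in \<open>auto simp: zero_prod_def\<close>)

lemma hits_imp_line:
  assumes "u \<noteq> 0"
  shows "\<exists>L. is_line L \<and> (\<forall>A. hits u A \<longrightarrow> L \<inter> A \<noteq> {})"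
proof -
  \<comment> \<open>The line at infinity hits nothing, so any genuine line may stand in for
    it.\<close>
  define a where "a = (if fst u = 0 then dir 0 else fst u)"
  have "a \<noteq> 0" by (simp add: a_def dir_nonzero)
  then have "is_line {q. a \<bullet> q = snd u}"
    by (simp add: is_line_def affine_hyperplane aff_dim_hyperplane)
  moreover have "{q. a \<bullet> q = snd u} \<inter> A \<noteq> {}" if "hits u A" for A
  proof -
    obtain q where q: "q \<in> A" "fst u \<bullet> q = snd u"
      using \<open>hits u A\<close> by (auto simp: hits_def)
    with assms have "fst u \<noteq> 0"
      by (auto simp: prod_eq_iff)
    with q show ?thesis by (auto simp: a_def)
  qed
  ultimately show ?thesis by blast
qed

lemma pierced3_imp_line_piercing_number_le:
  assumes "pierced3 F"
  shows "line_piercing_number F \<le> 3"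
proof -
  obtain u v w where uvw: "u \<noteq> 0" "v \<noteq> 0" "w \<noteq> 0"
    and hit: "\<And>A. A \<in> F \<Longrightarrow> hits u A \<or> hits v A \<or> hits w A"
    using assms by (auto simp: pierced3_def)
  obtain L where L: "is_line L" "\<And>A. hits u A \<Longrightarrow> L \<inter> A \<noteq> {}"
    using hits_imp_line[OF uvw(1)] by blast
  obtain M where M: "is_line M" "\<And>A. hits v A \<Longrightarrow> M \<inter> A \<noteq> {}"
    using hits_imp_line[OF uvw(2)] by blast
  obtain N where N: "is_line N" "\<And>A. hits w A \<Longrightarrow> N \<inter> A \<noteq> {}"
    using hits_imp_line[OF uvw(3)] by blast
  have "\<forall>K\<in>{L, M, N}. is_line K"
    using L M N by simp
  moreover have "\<Union>{L, M, N} \<inter> A \<noteq> {}" if "A \<in> F" for A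
    using hit[OF that] L(2)[of A] M(2)[of A] N(2)[of A] by blast
  \<comment> \<open>The lines may coincide, while \<open>pierced_by_lines\<close> asks for an exact
    number.\<close>
  ultimately have "pierced_by_lines F (card {L, M, N})"
    unfolding pierced_by_lines_def by (intro exI[of _ "{L, M, N}"]) simp
  then have "line_piercing_number F \<le> enat (card {L, M, N})"
    unfolding line_piercing_number_def by (intro INF_lower) auto
  also have "\<dots> \<le> enat 3"
    by (simp add: card_insert_if)
  finally show ?thesis by (simp add: numeral_eq_enat)
qed

section \<open>Reduction to finite families by compactness\<close>

lemma closed_hits:
  assumes "compact A"
  shows "closed {u. hits u A}"
proof -
  \<comment> \<open>Incidence of points and lines is closed, and projecting along the compact factor
    \<open>A\<close> preserves closedness.\<close>
  define Z where "Z = {z :: (real^2) \<times> ((real^2) \<times> real). fst (snd z) \<bullet> fst z = snd (snd z)}"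
  have "closed Z"
    unfolding Z_def by (intro closed_Collect_eq continuous_intros)
  then have "closedin (top_of_set (A \<times> UNIV)) ((A \<times> UNIV) \<inter> Z)"
    by (simp add: closedin_closed_Int)
  then have "closedin (top_of_set UNIV) {u. \<exists>q. q \<in> A \<and> (q, u) \<in> (A \<times> UNIV) \<inter> Z}"
    by (rule closedin_compact_projection[OF assms])
  then show ?thesis
    by (simp add: hits_def Bex_def Z_def)
qed

lemma hits_sgn: "hits (sgn u) A \<longleftrightarrow> hits u A"
proof (cases "u = 0")
  case False
  then show ?thesis
    by (simp add: hits_def sgn_div_norm)
qed simp

text \<open>Scaling puts the lines on the unit sphere, so triples range over a compact space in
  which the set \<open>T A\<close> of triples hitting \<open>A\<close> is closed. The finite
  intersection property applies.\<close>

lemma finite_subfamily_not_pierced3: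
  assumes "\<And>A. A \<in> F \<Longrightarrow> compact A" "\<not> pierced3 F"
  shows "\<exists>G\<subseteq>F. finite G \<and> \<not> pierced3 G"
proof (rule ccontr)
  assume no: "\<not> ?thesis"
  let ?S = "sphere 0 1 :: ((real^2) \<times> real) set"
  define T where "T A = {z. hits (fst z) A \<or> hits (fst (snd z)) A \<or> hits (snd (snd z)) A}" for A
  have closed_T: "closed (T A)" if "A \<in> F" for A
  proof -
    have "T A = fst -` {u. hits u A} \<union> (\<lambda>z. fst (snd z)) -` {u. hits u A}
        \<union> (\<lambda>z. snd (snd z)) -` {u. hits u A}"
      by (auto simp: T_def)
    then show ?thesis
      by (simp only:)
        (intro closed_Un closed_vimage closed_hits assms(1)[OF that] continuous_intros)
  qed
  have fip: "(?S \<times> ?S \<times> ?S) \<inter> \<Inter>H \<noteq> {}" if "finite H" "H \<subseteq> T ` F" for H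
  proof -
    obtain G where G: "G \<subseteq> F" "finite G" "H = T ` G"
      using finite_subset_image[OF \<open>finite H\<close> \<open>H \<subseteq> T ` F\<close>] by blast
    then have "pierced3 G"
      using no by blast
    then obtain u v w where "u \<noteq> 0" "v \<noteq> 0" "w \<noteq> 0" "\<forall>A\<in>G. hits u A \<or> hits v A \<or> hits w A"
      unfolding pierced3_def by blast
    then have "(sgn u, sgn v, sgn w) \<in> (?S \<times> ?S \<times> ?S) \<inter> \<Inter>H"
      by (auto simp: G T_def hits_sgn norm_sgn)
    then show ?thesis by blast
  qed
  have "(?S \<times> ?S \<times> ?S) \<inter> \<Inter>(T ` F) \<noteq> {}"
  proof (rule compact_imp_fip)
    show "compact (?S \<times> ?S \<times> ?S)"
      by (intro compact_Times compact_sphere)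
  qed (use closed_T fip in blast)+
  then obtain u v w where "u \<in> ?S" "v \<in> ?S" "w \<in> ?S" "(u, v, w) \<in> \<Inter>(T ` F)"
    by auto
  then have "pierced3 F"
    unfolding pierced3_def
    by (intro exI[of _ u] exI[of _ v] exI[of _ w]) (auto simp: T_def)
  then show False using assms(2) by simp
qed

text \<open>Projected to an axis, the sets become intervals. If those of \<open>F\<close> meet
  pairwise, Helly's theorem on the line gives a common point; otherwise every interval of
  \<open>G\<close> bridges the gap between two disjoint ones of \<open>F\<close>. One line suffices
  either way.\<close>

lemma cross_intersecting_imp_pierced3:
  assumes F: "\<And>A. A \<in> F \<Longrightarrow> compact A \<and> connected A"
    and G: "\<And>B. B \<in> G \<Longrightarrow> compact B \<and> connected B"
    and meet: "\<And>A B. A \<in> F \<Longrightarrow> B \<in> G \<Longrightarrow> convex hull A \<inter> convex hull B \<noteq> {}"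
  shows "pierced3 F \<or> pierced3 G"
proof (cases "F = {} \<or> G = {}")
  case True
  then show ?thesis
    using pierced3I[of "{}"] by auto
next
  case False
  define lo hi where "lo A = Inf ((\<bullet>) (dir 0) ` A)" and "hi A = Sup ((\<bullet>) (dir 0) ` A)" for A
  \<comment> \<open>An empty member would have an empty hull, which meets no hull from the other,
    nonempty family.\<close>
  have cc: "compact A \<and> connected A \<and> A \<noteq> {}" if "A \<in> F \<union> G" for A
    using that F G meet False by fastforce
  have cpt: "compact ((\<bullet>) (dir 0) ` A)" if "compact A" for A :: "(real^2) set"
    using that by (intro compact_continuous_image continuous_intros)
  have bd: "lo A \<le> dir 0 \<bullet> q" "dir 0 \<bullet> q \<le> hi A" if "A \<in> F \<union> G" "q \<in> A" for A q
    using that cc cpt[of A] compact_imp_bounded[of "(\<bullet>) (dir 0) ` A"]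
    by (auto simp: lo_def hi_def intro!: cInf_lower cSup_upper
        bounded_imp_bdd_above bounded_imp_bdd_below)
  have stab: "hits (dir 0, t) A" if "A \<in> F \<union> G" "lo A \<le> t" "t \<le> hi A" for A t
  proof -
    have "closed ((\<bullet>) (dir 0) ` A)" "bounded ((\<bullet>) (dir 0) ` A)" "(\<bullet>) (dir 0) ` A \<noteq> {}"
      using cc[OF that(1)] cpt compact_imp_bounded compact_imp_closed by auto
    then have "lo A \<in> (\<bullet>) (dir 0) ` A" "hi A \<in> (\<bullet>) (dir 0) ` A"
      unfolding lo_def hi_def
      by (auto intro!: closed_contains_Inf closed_contains_Sup
          bounded_imp_bdd_above bounded_imp_bdd_below)
    then obtain p q where "p \<in> A" "q \<in> A" "lo A = dir 0 \<bullet> p" "hi A = dir 0 \<bullet> q"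
      by blast
    with that have "p \<in> A" "q \<in> A" "dir 0 \<bullet> p \<le> t" "t \<le> dir 0 \<bullet> q"
      by simp_all
    then show ?thesis
      using connected_ivt_hyperplane[of A p q "dir 0" t] cc[OF that(1)] by (auto simp: hits_def)
  qed
  have hull: "lo A \<le> dir 0 \<bullet> q" "dir 0 \<bullet> q \<le> hi A" if "A \<in> F \<union> G" "q \<in> convex hull A" for A q
  proof -
    have "convex hull A \<subseteq> {q. dir 0 \<bullet> q \<ge> lo A} \<inter> {q. dir 0 \<bullet> q \<le> hi A}"
      using bd[OF that(1)]
      by (intro hull_minimal convex_Int convex_halfspace_ge convex_halfspace_le) auto
    then show "lo A \<le> dir 0 \<bullet> q" "dir 0 \<bullet> q \<le> hi A" using that(2) by auto
  qed
  have cross: "lo A \<le> hi B" "lo B \<le> hi A" if AB: "A \<in> F" "B \<in> G" for A B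
  proof -
    obtain q where "q \<in> convex hull A" "q \<in> convex hull B"
      using meet[OF AB] by blast
    then show "lo A \<le> hi B" "lo B \<le> hi A"
      using hull[of A q] hull[of B q] AB by fastforce+
  qed
  show ?thesis
  proof (cases "\<forall>A\<in>F. \<forall>B\<in>F. lo A \<le> hi B")
    case True
    define t where "t = Sup (lo ` F)"
    have "hits (dir 0, t) A" if "A \<in> F" for A
    proof (rule stab)
      show "lo A \<le> t"
        unfolding t_def using that True by (intro cSup_upper) (auto intro!: bdd_aboveI2)
      show "t \<le> hi A"
        unfolding t_def using that True by (intro cSup_least) auto
    qed (use that in simp)
    then show ?thesis
      using pierced3I by blast
  next
    case False
    then obtain A B where AB: "A \<in> F" "B \<in> F" "hi B < lo A"
      by (auto simp: not_le)
    have "hits (dir 0, hi B) C" if "C \<in> G" for C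
      using cross[OF AB(1) that] cross[OF AB(2) that] AB(3) that by (intro stab) auto
    then show ?thesis
      using pierced3I by blast
  qed
qed

subsection \<open>Wedges over six arcs\<close>

lemma not_tight_tripleI:
  assumes "convex P" "convex Q" "convex S" "P \<inter> Q \<inter> S = {}"
    and "A \<union> B \<subseteq> P" "A \<union> C \<subseteq> Q" "B \<union> C \<subseteq> S"
  shows "\<not> tight_triple A B C"
proof -
  have "convex hull (A \<union> B) \<subseteq> P" "convex hull (A \<union> C) \<subseteq> Q" "convex hull (B \<union> C) \<subseteq> S"
    using assms by (simp_all add: hull_minimal)
  then show ?thesis
    using assms(4) unfolding tight_triple_def by blast
qed

lemma tight_triple_swap:
  "tight_triple A B C \<longleftrightarrow> tight_triple B A C" "tight_triple A B C \<longleftrightarrow> tight_triple A C B"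
  by (auto simp: tight_triple_def Un_commute Int_ac)

lemma bij_betw_of_nat_6: "bij_betw of_nat {..<6} (UNIV :: 6 set)"
proof -
  have "(x :: 6) \<in> of_nat ` {..<6}" for x
  proof (cases x)
    case (of_int z)
    then show ?thesis
      by (intro image_eqI[of _ _ "nat z"]) auto
  qed
  then have "of_nat ` {..<6} = (UNIV :: 6 set)" by auto
  moreover from this have "inj_on (of_nat :: nat \<Rightarrow> 6) {..<6}"
    by (intro eq_card_imp_inj_on) simp_all
  ultimately show ?thesis by (simp add: bij_betw_def)
qed

text \<open>The arcs have lengths \<open>2\<pi> x\<^sub>0, \<dots>, 2\<pi> x\<^sub>5\<close>; \<open>of_nat\<close> reduces modulo \<open>6\<close>, so \<open>arc_angle x\<close>
  runs around the circle repeatedly.\<close>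

definition arc_angle :: "real^6 \<Rightarrow> nat \<Rightarrow> real" where
  "arc_angle x n = 2 * pi * (\<Sum>l<n. x $ of_nat l)"

text \<open>On the simplex, \<open>n\<close> and \<open>n + 3\<close> give the same line with
  opposite signs, so there are only three lines.\<close>

definition diagonal :: "real \<Rightarrow> real^6 \<Rightarrow> nat \<Rightarrow> real^2 \<Rightarrow> real" where
  "diagonal R x n = chord R (arc_angle x n) (arc_angle x (n + 3))"

text \<open>The two chords start at the ends of the \<open>n\<close>-th arc. The second sign is
  negative because this arc lies just before the starting point of the second chord.\<close>

definition wedge :: "real \<Rightarrow> real^6 \<Rightarrow> nat \<Rightarrow> (real^2) set" where
  "wedge R x n = {q. diagonal R x n q > 0 \<and> diagonal R x (Suc n) q < 0}"

lemma arc_angle_mono: "x \<in> unit_simplex \<Longrightarrow> m \<le> n \<Longrightarrow> arc_angle x m \<le> arc_angle x n"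
  unfolding arc_angle_def unit_simplex_def by (auto intro!: mult_left_mono sum_mono2)

lemma arc_angle_add_6:
  assumes "x \<in> unit_simplex"
  shows "arc_angle x (n + 6) = arc_angle x n + 2 * pi"
proof (induction n)
  case 0
  have "(\<Sum>l<6. x $ of_nat l) = 1"
    using sum.reindex_bij_betw[OF bij_betw_of_nat_6, of "($) x"] assms
    by (simp add: unit_simplex_def)
  then show ?case by (simp add: arc_angle_def)
next
  case (Suc n)
  have "of_nat (n + 6) = (of_nat n :: 6)" by simp
  then have "arc_angle x (Suc n + 6) = arc_angle x (n + 6) + 2 * pi * x $ of_nat n"
    by (simp only: add_Suc arc_angle_def sum.lessThan_Suc distrib_left)
  then show ?case
    using Suc by (simp add: arc_angle_def distrib_left)
qed

lemma diagonal_add_3: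
  assumes "x \<in> unit_simplex"
  shows "diagonal R x (n + 3) q = - diagonal R x n q"
proof -
  have "n + 3 + 3 = n + 6" by simp
  then show ?thesis
    by (simp only: diagonal_def arc_angle_add_6[OF assms] chord_swap)
qed

lemma diagonal_continuous: "continuous_on S (\<lambda>p. diagonal R (fst p) n (snd p))"
  unfolding diagonal_def chord_def inner_dir arc_angle_def
  by (intro continuous_intros) auto

text \<open>Both chords start at the same point and the second ends no earlier, so by
  \<open>chord_monotone\<close> a point of the disc positive for the first is not negative for the
  second.\<close>

lemma wedge_facet:
  assumes "x \<in> unit_simplex" "x $ of_nat n = 0" "norm q \<le> R"
  shows "q \<notin> wedge R x n"
proof -
  have eq: "arc_angle x (Suc n) = arc_angle x n"
    using assms(2) by (simp add: arc_angle_def)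
  have "diagonal R x (Suc n) q \<ge> 0" if "diagonal R x n q > 0"
    unfolding diagonal_def eq
  proof (rule chord_monotone[OF assms(3)])
    show "chord R (arc_angle x n) (arc_angle x (n + 3)) q > 0"
      using that by (simp add: diagonal_def)
    show "arc_angle x (Suc n + 3) \<le> arc_angle x n + 2 * pi"
      using arc_angle_mono[OF assms(1), of "Suc n + 3" "n + 6"] arc_angle_add_6[OF assms(1), of n]
      by simp
  qed (use arc_angle_mono[OF assms(1)] in auto)
  then show ?thesis by (force simp: wedge_def)
qed

text \<open>Lying outside the wedge is a closed condition on \<open>x\<close> and the point jointly;
  its compact solution set over \<open>A\<close> is projected to the simplex.\<close>

lemma closed_not_in_wedge:
  assumes "compact A"
  shows "closed {x \<in> unit_simplex. \<not> A \<subseteq> wedge R x n}"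
proof -
  define Z where "Z = {p. diagonal R (fst p) n (snd p) \<le> 0} \<union> {p. diagonal R (fst p) (Suc n) (snd p) \<ge> 0}"
  have "closed Z"
    unfolding Z_def
    by (intro closed_Un closed_Collect_le diagonal_continuous continuous_on_const)
  then have "compact ((unit_simplex \<times> A) \<inter> Z)"
    using assms by (intro compact_Int_closed compact_Times compact_unit_simplex)
  then have "compact (fst ` ((unit_simplex \<times> A) \<inter> Z))"
    by (intro compact_continuous_image continuous_intros)
  moreover have "fst ` ((unit_simplex \<times> A) \<inter> Z) = {x \<in> unit_simplex. \<not> A \<subseteq> wedge R x n}"
    by (force simp: Z_def wedge_def not_less)
  ultimately show ?thesis
    by (metis compact_imp_closed)
qed

lemma diagonal_eq:
  "diagonal R x n q = dir ((arc_angle x n + arc_angle x (n + 3)) / 2) \<bullet> q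
    - R * cos ((arc_angle x (n + 3) - arc_angle x n) / 2)"
  by (simp add: diagonal_def chord_def)

text \<open>By \<open>diagonal_add_3\<close> three signs decide all wedges. Each of the eight sign
  patterns lies in some wedge; + - + lies in wedges 0, 2, 4 and - + - in wedges 1, 3, 5.\<close>

lemma wedge_signs:
  assumes "x \<in> unit_simplex"
  shows "q \<in> wedge R x 0 \<longleftrightarrow> diagonal R x 0 q > 0 \<and> diagonal R x 1 q < 0"
    and "q \<in> wedge R x 1 \<longleftrightarrow> diagonal R x 1 q > 0 \<and> diagonal R x 2 q < 0"
    and "q \<in> wedge R x 2 \<longleftrightarrow> diagonal R x 2 q > 0 \<and> diagonal R x 0 q > 0"
    and "q \<in> wedge R x 3 \<longleftrightarrow> diagonal R x 0 q < 0 \<and> diagonal R x 1 q > 0"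
    and "q \<in> wedge R x 4 \<longleftrightarrow> diagonal R x 1 q < 0 \<and> diagonal R x 2 q > 0"
    and "q \<in> wedge R x 5 \<longleftrightarrow> diagonal R x 2 q < 0 \<and> diagonal R x 0 q < 0"
proof -
  have flip: "diagonal R x 3 q = - diagonal R x 0 q" "diagonal R x 4 q = - diagonal R x 1 q"
    "diagonal R x 5 q = - diagonal R x 2 q" "diagonal R x 6 q = diagonal R x 0 q"
    using diagonal_add_3[OF assms, of R 0] diagonal_add_3[OF assms, of R 1]
      diagonal_add_3[OF assms, of R 2] diagonal_add_3[OF assms, of R 3] by simp_all
  have Suc: "Suc 0 = 1" "Suc 1 = 2" "Suc 2 = 3" "Suc 3 = 4" "Suc 4 = 5" "Suc 5 = 6"
    by simp_all
  show "q \<in> wedge R x 0 \<longleftrightarrow> diagonal R x 0 q > 0 \<and> diagonal R x 1 q < 0"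
    "q \<in> wedge R x 1 \<longleftrightarrow> diagonal R x 1 q > 0 \<and> diagonal R x 2 q < 0"
    "q \<in> wedge R x 2 \<longleftrightarrow> diagonal R x 2 q > 0 \<and> diagonal R x 0 q > 0"
    "q \<in> wedge R x 3 \<longleftrightarrow> diagonal R x 0 q < 0 \<and> diagonal R x 1 q > 0"
    "q \<in> wedge R x 4 \<longleftrightarrow> diagonal R x 1 q < 0 \<and> diagonal R x 2 q > 0"
    "q \<in> wedge R x 5 \<longleftrightarrow> diagonal R x 2 q < 0 \<and> diagonal R x 0 q < 0"
    unfolding wedge_def mem_Collect_eq Suc flip by auto
qed

text \<open>Some member misses all three diagonals; being connected, it has one sign on each, and
  every sign pattern falls into a wedge.\<close>

lemma not_pierced3_imp_in_wedge:
  assumes "x \<in> unit_simplex" "\<not> pierced3 F" "\<And>A. A \<in> F \<Longrightarrow> connected A"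
  shows "\<exists>A\<in>F. \<exists>n<6. A \<subseteq> wedge R x n"
proof -
  define m c where "m n = (arc_angle x n + arc_angle x (n + 3)) / 2"
    and "c n = R * cos ((arc_angle x (n + 3) - arc_angle x n) / 2)" for n
  obtain A where A: "A \<in> F" "\<not> hits (dir (m 0), c 0) A" "\<not> hits (dir (m 1), c 1) A"
      "\<not> hits (dir (m 2), c 2) A"
    using assms(2) pierced3I by meson
  have side: "(\<forall>q\<in>A. diagonal R x n q > 0) \<or> (\<forall>q\<in>A. diagonal R x n q < 0)"
    if "\<not> hits (dir (m n), c n) A" for n
    using not_hits_imp_one_side[OF assms(3)[OF A(1)] that] by (simp add: diagonal_eq m_def c_def)
  have "A \<subseteq> wedge R x 0 \<or> A \<subseteq> wedge R x 1 \<or> A \<subseteq> wedge R x 2 \<or> A \<subseteq> wedge R x 3 \<or>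
      A \<subseteq> wedge R x 4 \<or> A \<subseteq> wedge R x 5"
    using side[OF A(2)] side[OF A(3)] side[OF A(4)]
    unfolding subset_iff wedge_signs[OF assms(1)] by blast
  then have "\<exists>n<6. A \<subseteq> wedge R x n"
    by (elim disjE) (rule exI, rule conjI[rotated], assumption, simp)+
  then show ?thesis using A(1) by blast
qed

text \<open>Any two of the wedges 0, 2, 4 share a half-plane of one diagonal, so the three hulls
  meet only inside the pattern + - +. Likewise 1, 3, 5 lead to - + -. One of these patterns is empty
  by \<open>sign_pattern_excluded\<close>.\<close>

lemma wedges_not_tight:
  assumes x: "x \<in> unit_simplex" and A: "\<And>n. n < 6 \<Longrightarrow> A n \<subseteq> wedge R x n"
  shows "\<not> tight_triple (A 0) (A 2) (A 4) \<or> \<not> tight_triple (A 1) (A 3) (A 5)"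
proof -
  have conv: "convex {q. diagonal R x n q > 0}" "convex {q. diagonal R x n q < 0}" for n
    by (simp_all add: diagonal_eq convex_halfspace_gt convex_halfspace_lt)
  have in_wedge: "q \<in> wedge R x n" if "n < 6" "q \<in> A n" for n q
    using A that by blast
  note signs = in_wedge[of 0, unfolded wedge_signs[OF x]] in_wedge[of 1, unfolded wedge_signs[OF x]]
    in_wedge[of 2, unfolded wedge_signs[OF x]] in_wedge[of 3, unfolded wedge_signs[OF x]]
    in_wedge[of 4, unfolded wedge_signs[OF x]] in_wedge[of 5, unfolded wedge_signs[OF x]]
  have mono: "arc_angle x 0 \<le> arc_angle x 1" "arc_angle x 1 \<le> arc_angle x 2"
    "arc_angle x 2 \<le> arc_angle x 3" "arc_angle x 3 \<le> arc_angle x 4"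
    "arc_angle x 4 \<le> arc_angle x 5"
    by (simp_all add: arc_angle_mono[OF x])
  have period: "arc_angle x 5 \<le> arc_angle x 0 + 2 * pi"
    using arc_angle_mono[OF x, of 5 6] arc_angle_add_6[OF x, of 0] by simp
  define m c where "m n = (arc_angle x n + arc_angle x (n + 3)) / 2"
    and "c n = R * cos ((arc_angle x (n + 3) - arc_angle x n) / 2)" for n
  have m: "m 0 = (arc_angle x 0 + arc_angle x 3) / 2" "m 1 = (arc_angle x 1 + arc_angle x 4) / 2"
    "m 2 = (arc_angle x 2 + arc_angle x 5) / 2"
    by (simp_all add: m_def)
  have "(\<forall>q. \<not> (dir (m 0) \<bullet> q > c 0 \<and> dir (m 1) \<bullet> q < c 1 \<and> dir (m 2) \<bullet> q > c 2)) \<or>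
      (\<forall>q. \<not> (dir (m 0) \<bullet> q < c 0 \<and> dir (m 1) \<bullet> q > c 1 \<and> dir (m 2) \<bullet> q < c 2))"
  proof (rule sign_pattern_excluded)
    \<comment> \<open>The angles are monotone, so equal midpoints force equal endpoints and thus the
      same chord.\<close>
    show "c 0 = c 1" if "m 0 = m 1"
    proof -
      have "arc_angle x 0 + arc_angle x 3 = arc_angle x 1 + arc_angle x 4"
        using that m by simp
      then have "arc_angle x 0 = arc_angle x 1" "arc_angle x 3 = arc_angle x 4"
        using mono by simp_all
      then show ?thesis by (simp add: c_def)
    qed
    show "c 1 = c 2" if "m 1 = m 2"
    proof -
      have "arc_angle x 1 + arc_angle x 4 = arc_angle x 2 + arc_angle x 5"
        using that m by simp
      then have "arc_angle x 1 = arc_angle x 2" "arc_angle x 4 = arc_angle x 5"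
        using mono by simp_all
      then show ?thesis by (simp add: c_def)
    qed
    show "m 0 \<le> m 1" "m 1 \<le> m 2"
      unfolding m using mono by simp_all
    have "arc_angle x 2 + arc_angle x 5 \<le> arc_angle x 0 + arc_angle x 3 + 2 * pi"
      using mono period by simp
    then show "m 2 \<le> m 0 + pi"
      unfolding m by (simp add: field_simps)
  qed
  then consider
      "\<And>q. \<not> (diagonal R x 0 q > 0 \<and> diagonal R x 1 q < 0 \<and> diagonal R x 2 q > 0)"
    | "\<And>q. \<not> (diagonal R x 0 q < 0 \<and> diagonal R x 1 q > 0 \<and> diagonal R x 2 q < 0)"
    by (auto simp: diagonal_eq m_def c_def)
  then show ?thesis
  proof cases
    case 1
    have "\<not> tight_triple (A 0) (A 2) (A 4)"
      by (rule not_tight_tripleI[OF conv(1)[of 0] conv(2)[of 1] conv(1)[of 2]])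
        (use 1 signs in auto)
    then show ?thesis ..
  next
    case 2
    have "\<not> tight_triple (A 1) (A 3) (A 5)"
      by (rule not_tight_tripleI[OF conv(1)[of 1] conv(2)[of 2] conv(2)[of 0]])
        (use 2 signs in auto)
    then show ?thesis ..
  qed
qed

section \<open>Applying the colourful KKM theorem to the wedges\<close>

lemma bounded_colourful:
  fixes F :: "'c \<Rightarrow> (real^2) set set"
  assumes J: "card J = 6"
    and F: "\<And>j A. j \<in> J \<Longrightarrow> A \<in> F j \<Longrightarrow> compact A \<and> connected A \<and> A \<noteq> {} \<and> A \<subseteq> cball 0 R"
    and np: "\<And>j. j \<in> J \<Longrightarrow> \<not> pierced3 (F j)"
  shows "\<exists>i\<in>J. \<exists>j\<in>J. \<exists>k\<in>J. \<exists>A\<in>F i. \<exists>B\<in>F j. \<exists>C\<in>F k.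
    i \<noteq> j \<and> j \<noteq> k \<and> i \<noteq> k \<and> \<not> tight_triple A B C"
proof -
  \<comment> \<open>Wedges are numbered by naturals, coordinates by residues; \<open>idx\<close>
    picks the representative below 6.\<close>
  define idx where "idx = inv_into {..<6} (of_nat :: nat \<Rightarrow> 6)"
  have idx: "of_nat (idx i) = i" "idx i < 6" for i
    using bij_betw_inv_into_right[OF bij_betw_of_nat_6, of i]
      bij_betw_apply[OF bij_betw_inv_into[OF bij_betw_of_nat_6], of i]
    by (auto simp: idx_def)
  have idx_of_nat: "idx (of_nat n) = n" if "n < 6" for n
    using bij_betw_inv_into_left[OF bij_betw_of_nat_6, of n] that by (simp add: idx_def)
  \<comment> \<open>\<open>C j i\<close> collects the \<open>x\<close> for which no member of
    \<open>F j\<close> fits into the \<open>i\<close>-th wedge.\<close>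
  define C where "C j i = unit_simplex \<inter> (\<Inter>A\<in>F j. {x \<in> unit_simplex. \<not> A \<subseteq> wedge R x (idx i)})" for j i
  have "\<exists>x\<in>unit_simplex. \<exists>r. inj r \<and> (\<forall>i. r i \<in> J \<and> x \<notin> C (r i) i)"
  proof (rule colourful_KKM)
    show "closed (C j i)" if "j \<in> J" for j i
      unfolding C_def using F[OF that]
      by (intro closed_Int closed_INT ballI closed_not_in_wedge compact_imp_closed
          compact_unit_simplex) auto
    show "x \<in> C j i" if "j \<in> J" "x \<in> unit_simplex" "x $ i = 0" for j i x
    proof -
      \<comment> \<open>Nonemptiness matters: \<open>A\<close> has a point in the disc, and the
        wedge over an arc of length zero misses the disc.\<close>
      have "\<not> A \<subseteq> wedge R x (idx i)" if "A \<in> F j" for A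
      proof -
        have "A \<noteq> {}" "A \<subseteq> cball 0 R"
          using F[OF \<open>j \<in> J\<close> that] by auto
        then obtain q where "q \<in> A" "norm q \<le> R"
          by (meson ex_in_conv mem_cball_0 subsetD)
        then show ?thesis
          using wedge_facet[of x "idx i" q R] \<open>x \<in> unit_simplex\<close> \<open>x $ i = 0\<close> idx by auto
      qed
      then show ?thesis using that by (auto simp: C_def)
    qed
    show "\<exists>i. x \<notin> C j i" if jx: "j \<in> J" "x \<in> unit_simplex" for j x
    proof -
      obtain A n where "A \<in> F j" "n < 6" "A \<subseteq> wedge R x n"
        using not_pierced3_imp_in_wedge[OF jx(2) np[OF jx(1)], of R] F[OF jx(1)] by blast
      then have "x \<notin> C j (of_nat n)"
        by (auto simp: C_def idx_of_nat)
      then show ?thesis ..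
    qed
  qed (use J in simp)
  then obtain x r where x: "x \<in> unit_simplex" and r: "inj r" "\<And>i. r i \<in> J" "\<And>i. x \<notin> C (r i) i"
    by blast
  have "\<exists>A. A \<in> F (r (of_nat n)) \<and> A \<subseteq> wedge R x n" if "n < 6" for n
    using r(3)[of "of_nat n"] x idx_of_nat[OF that] by (auto simp: C_def)
  then obtain A where A: "\<And>n. n < 6 \<Longrightarrow> A n \<in> F (r (of_nat n))" "\<And>n. n < 6 \<Longrightarrow> A n \<subseteq> wedge R x n"
    by metis
  have ne: "r (of_nat m) \<noteq> r (of_nat n)" if "m < 6" "n < 6" "m \<noteq> n" for m n
    using that r(1) idx_of_nat by (metis injD)
  have "\<not> tight_triple (A 0) (A 2) (A 4) \<or> \<not> tight_triple (A 1) (A 3) (A 5)"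
    using x A(2) by (rule wedges_not_tight)
  then obtain k l m where klm: "k < 6" "l < 6" "m < 6" "k \<noteq> l" "l \<noteq> m" "k \<noteq> m"
      "\<not> tight_triple (A k) (A l) (A m)"
  proof
    assume "\<not> tight_triple (A 0) (A 2) (A 4)"
    then show thesis by (rule that[rotated 6]) simp_all
  next
    assume "\<not> tight_triple (A 1) (A 3) (A 5)"
    then show thesis by (rule that[rotated 6]) simp_all
  qed
  show ?thesis
    by (intro bexI[of _ "r (of_nat k)"] bexI[of _ "r (of_nat l)"] bexI[of _ "r (of_nat m)"]
        bexI[of _ "A k"] bexI[of _ "A l"] bexI[of _ "A m"] conjI klm ne A r)
qed

theorem theorem1p1:
  fixes \<F> :: "nat \<Rightarrow> (real^2) set set"
  assumes "\<And>i A. i \<in> {1..6} \<Longrightarrow> A \<in> \<F> i \<Longrightarrow> compact A \<and> connected A"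
    and "\<And>i\<^sub>1 i\<^sub>2 i\<^sub>3 A\<^sub>1 A\<^sub>2 A\<^sub>3.
           1 \<le> i\<^sub>1 \<Longrightarrow> i\<^sub>1 < i\<^sub>2 \<Longrightarrow> i\<^sub>2 < i\<^sub>3 \<Longrightarrow> i\<^sub>3 \<le> 6 \<Longrightarrow>
           A\<^sub>1 \<in> \<F> i\<^sub>1 \<Longrightarrow> A\<^sub>2 \<in> \<F> i\<^sub>2 \<Longrightarrow> A\<^sub>3 \<in> \<F> i\<^sub>3 \<Longrightarrow> tight_triple A\<^sub>1 A\<^sub>2 A\<^sub>3"
  shows "\<exists>i\<in>{1..6}. line_piercing_number (\<F> i) \<le> 3"
proof (rule ccontr)
  assume "\<not> ?thesis"
  then have np: "\<not> pierced3 (\<F> i)" if "i \<in> {1..6}" for i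
    using that pierced3_imp_line_piercing_number_le by blast
  have tight: "tight_triple A B C"
    if idx: "i \<in> {1..6}" "j \<in> {1..6}" "k \<in> {1..6}" "i \<noteq> j" "j \<noteq> k" "i \<noteq> k"
      and mem: "A \<in> \<F> i" "B \<in> \<F> j" "C \<in> \<F> k" for i j k A B C
  proof -
    \<comment> \<open>Symmetry of tightness carries the assumption from increasing indices to all
      six orders.\<close>
    have sorted: "tight_triple A' B' C'" if "i' < j'" "j' < k'"
      "i' \<in> {1..6}" "k' \<in> {1..6}" "A' \<in> \<F> i'" "B' \<in> \<F> j'" "C' \<in> \<F> k'" for i' j' k' A' B' C'
      using that assms(2)[of i' j' k' A' B' C'] by simp
    note perm = tight_triple_swap(1)[of A B C] tight_triple_swap(2)[of A B C]
      tight_triple_swap(2)[of B A C] tight_triple_swap(1)[of A C B] tight_triple_swap(1)[of B C A]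
    consider "i < j \<and> j < k" | "i < k \<and> k < j" | "j < i \<and> i < k" | "j < k \<and> k < i"
      | "k < i \<and> i < j" | "k < j \<and> j < i"
      using idx(4-6) by (metis linorder_neqE_nat)
    then show ?thesis
    proof cases
      case 1
      then show ?thesis using sorted[of i j k A B C] idx mem by simp
    next
      case 2
      then show ?thesis using sorted[of i k j A C B] idx mem perm by simp
    next
      case 3
      then show ?thesis using sorted[of j i k B A C] idx mem perm by simp
    next
      case 4
      then show ?thesis using sorted[of j k i B C A] idx mem perm by simp
    next
      case 5
      then show ?thesis using sorted[of k i j C A B] idx mem perm by simp
    next
      case 6
      then show ?thesis using sorted[of k j i C B A] idx mem perm by simp
    qed
  qed
  \<comment> \<open>The empty set would lie in every wedge. If it belongs to one family, tightness
    makes the hulls from any two other families meet, so one of those is pierced.\<close>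
  have ne: "{} \<notin> \<F> i" if i: "i \<in> {1..6}" for i
  proof
    assume empty: "{} \<in> \<F> i"
    obtain j k :: nat where jk: "j \<in> {1..6}" "k \<in> {1..6}" "i \<noteq> j" "j \<noteq> k" "i \<noteq> k"
    proof (cases "i \<le> 2")
      case True
      then show ?thesis using that[of 3 4] by simp
    next
      case False
      then show ?thesis using that[of 1 2] by simp
    qed
    have "convex hull B \<inter> convex hull C \<noteq> {}" if "B \<in> \<F> j" "C \<in> \<F> k" for B C
      using tight[OF i jk(1,2) jk(3-5) empty that] by (auto simp: tight_triple_def)
    then have "pierced3 (\<F> j) \<or> pierced3 (\<F> k)"
      using assms(1) jk(1,2) by (intro cross_intersecting_imp_pierced3) auto
    then show False using np jk by blast
  qed
  \<comment> \<open>Finite unpierced subfamilies consist of finitely many compact sets, which gives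
    the common radius \<open>R\<close>.\<close>
  have "\<forall>i\<in>{1..6}. \<exists>G\<subseteq>\<F> i. finite G \<and> \<not> pierced3 G"
    using finite_subfamily_not_pierced3 np assms(1) by meson
  then obtain G where G: "\<And>i. i \<in> {1..6} \<Longrightarrow> G i \<subseteq> \<F> i \<and> finite (G i) \<and> \<not> pierced3 (G i)"
    by metis
  have "bounded (\<Union>(G i))" if "i \<in> {1..6}" for i
  proof (intro bounded_Union ballI)
    show "bounded A" if "A \<in> G i" for A
      using assms(1)[of i A] G[OF \<open>i \<in> {1..6}\<close>] that \<open>i \<in> {1..6}\<close> compact_imp_bounded by blast
  qed (use G that in simp)
  then have "bounded (\<Union>i\<in>{1..6}. \<Union>(G i))"
    by (intro bounded_UN) auto
  then obtain R where R: "(\<Union>i\<in>{1..6}. \<Union>(G i)) \<subseteq> cball 0 R"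
    unfolding bounded_iff subset_iff mem_cball_0 by blast
  have "\<exists>i\<in>{1..6}. \<exists>j\<in>{1..6}. \<exists>k\<in>{1..6}. \<exists>A\<in>G i. \<exists>B\<in>G j. \<exists>C\<in>G k.
      i \<noteq> j \<and> j \<noteq> k \<and> i \<noteq> k \<and> \<not> tight_triple A B C"
  proof (rule bounded_colourful)
    show "compact A \<and> connected A \<and> A \<noteq> {} \<and> A \<subseteq> cball 0 R" if "i \<in> {1..6}" "A \<in> G i" for i A
    proof -
      have "A \<in> \<F> i"
        using G that by blast
      then show ?thesis
        using that assms(1)[of i A] ne[of i] R by blast
    qed
  qed (use G in auto)
  then show False
    using tight G by blast
qed

end
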